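(* Let $m\in\mathbb N_{\ge1}$. There exists a number $N(m)\le(2m+1)\uparrow\uparrow5$ such that for every $\varepsilon>0$ there is no deterministic $(m-\varepsilon)$-competitive online algorithm for Online Makespan Hypergraph Coloring with $m$ colors, even when restricted to hyperforests with $N(m)$ nodes in which every hyperedge has at most $m$ nodes.
   Context: Online Makespan Hypergraph Coloring with $m$ colors: a hypergraph $\mathcal H=(V,E)$ with nodes $V=[n]$ is revealed online; nodes are revealed in the order $1,2,\dots,n$, and when node $j$ is revealed the algorithm learns the partial hyperedges $e\cap[j]$ for all $e\in E$, and must then irrevocably assign $j$ a color $c(j)\in[m]$. The objective (makespan) is $\max_{i\in[m]}\max_{e\in E}|c^{-1}(i)\cap e|$, to be minimized. A deterministic online algorithm is $r$-competitive if on every instance its objective value is at most $r$ times the minimum objective over all colorings $[n]\to[m]$. A hypercycle is a sequence $v_1,e_1,v_2,\dots,e_\ell,v_{\ell+1}=v_1$ with pairwise distinct hyperedges $e_t$ such that $v_t,v_{t+1}\in e_t$; a hyperforest is a hypergraph without hypercycle. Notation: $x\uparrow\uparrow5=x^{x^{x^{x^{x}}}}$ (tower of height 5).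
   Formalization: In the definition of a hypercycle, consecutive nodes are additionally required to differ (v_t ≠ v_{t+1}); without this, v,e,v would be a hypercycle for every node v of a hyperedge e, and hyperforests would have no nonempty hyperedges. *)

theory Defs
  imports Complex_Main "HOL-Library.FuncSet"
begin

text \<open>
  The nodes of an instance are \<open>1, \<dots>, n\<close>. The (finite) set of hyperedges is given by an enumeration
  \<open>es\<close> without repetitions, so that the family of the sets \<open>e \<inter> [j]\<close>, for all hyperedges \<open>e\<close>, can be
  shown to an algorithm as a list: equal partial hyperedges are not merged, and the positions tell
  which partial hyperedges belong to the same \<open>e\<close> in different steps. The enumeration is arbitrary
  and part of the instance.
\<close>

definition hypergraph :: "nat \<Rightarrow> nat set list \<Rightarrow> bool" where
  "hypergraph n es \<longleftrightarrow> distinct es \<and> (\<forall>e \<in> set es. e \<subseteq> {1..n})"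

text \<open>
  The condition \<open>v t \<noteq> v (t + 1)\<close> excludes degenerate sequences; without it, \<open>v, e, v\<close> would be a
  hypercycle for every \<open>v \<in> e\<close>. In particular it forces \<open>l \<ge> 2\<close>.
\<close>

definition hypercycle :: "nat set set \<Rightarrow> nat \<Rightarrow> (nat \<Rightarrow> nat) \<Rightarrow> (nat \<Rightarrow> nat set) \<Rightarrow> bool" where
  "hypercycle E l v f \<longleftrightarrow>
     l \<ge> 1 \<and> v (l + 1) = v 1 \<and> inj_on f {1..l} \<and>
     (\<forall>t \<in> {1..l}. f t \<in> E \<and> v t \<in> f t \<and> v (t + 1) \<in> f t \<and> v t \<noteq> v (t + 1))"

definition hyperforest :: "nat set set \<Rightarrow> bool" where
  "hyperforest E \<longleftrightarrow> \<not> (\<exists>l v f. hypercycle E l v f)"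

text \<open>On \<open>nat\<close>, the supremum of a finite nonempty set is its maximum, and that of the empty set is 0.\<close>

definition makespan :: "nat \<Rightarrow> nat set set \<Rightarrow> (nat \<Rightarrow> nat) \<Rightarrow> nat" where
  "makespan m E c = (SUP i \<in> {1..m}. SUP e \<in> E. card (c -` {i} \<inter> e))"

definition opt_makespan :: "nat \<Rightarrow> nat \<Rightarrow> nat set set \<Rightarrow> nat" where
  "opt_makespan m n E = Min (makespan m E ` ({1..n} \<rightarrow>\<^sub>E {1..m}))"

text \<open>
  A deterministic online algorithm maps the revealed node \<open>j\<close> and the current partial hyperedges to a
  color. The partial hyperedges of earlier steps are the restrictions of the current ones, and the
  algorithm's own earlier choices are determined by these, so this is the whole history.
\<close>

type_synonym online_alg = "nat \<Rightarrow> nat set list \<Rightarrow> nat"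

definition online_algorithm :: "nat \<Rightarrow> online_alg \<Rightarrow> bool" where
  "online_algorithm m A \<longleftrightarrow> (\<forall>j ps. A j ps \<in> {1..m})"

definition online_coloring :: "online_alg \<Rightarrow> nat set list \<Rightarrow> nat \<Rightarrow> nat" where
  "online_coloring A es j = A j (map (\<lambda>e. e \<inter> {1..j}) es)"

definition competitive_on :: "(nat \<times> nat set list) set \<Rightarrow> nat \<Rightarrow> real \<Rightarrow> online_alg \<Rightarrow> bool" where
  "competitive_on C m r A \<longleftrightarrow>
     (\<forall>(n, es) \<in> C. real (makespan m (set es) (online_coloring A es))
                     \<le> r * real (opt_makespan m n (set es)))"

fun tower :: "nat \<Rightarrow> nat \<Rightarrow> nat" where
  "tower x 0 = 1"
| "tower x (Suc h) = x ^ tower x h"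

end

theory Submission
  imports Defs "HOL-Combinatorics.Transposition" "HOL-Library.Disjoint_Sets"
begin

text \<open>
  The adversary keeps a stock of monochromatic partial hyperedges in pairwise different components.
  Given a size \<open>k a\<close> for every color \<open>a\<close> such that the stock contains hyperedges of color \<open>a\<close> and
  size \<open>k a\<close>, a new node is added to one of them for each color; whichever color \<open>b\<close> it receives, a
  monochromatic hyperedge of color \<open>b\<close> and size \<open>k b + 1\<close> arises. Repeating this, by the pigeonhole
  principle, one size \<open>k b\<close> can be increased at the cost of dividing the stock by \<open>m + 1\<close>. After at
  most \<open>m * (m - 1) + 1\<close> rounds some \<open>k b\<close> equals \<open>m\<close>. As a new node only ever connects different
  components, the hypergraph is a hyperforest, and permuting the colors within the components before
  each connection yields an offline coloring in which every hyperedge is rainbow.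
\<close>

section \<open>Families of hyperedges built by joining components\<close>

text \<open>The function \<open>\<kappa>\<close> labels the components; distinct components may share a label.\<close>

definition separates :: "('a \<Rightarrow> 'b) \<Rightarrow> ('i \<Rightarrow> 'a set) \<Rightarrow> 'i set \<Rightarrow> bool" where
  "separates \<kappa> P L \<longleftrightarrow>
     (\<forall>i. \<forall>x \<in> P i. \<forall>y \<in> P i. \<kappa> x = \<kappa> y) \<and> disjoint_family_on (\<lambda>i. \<kappa> ` P i) L"

lemma separatesD_eq: "separates \<kappa> P L \<Longrightarrow> x \<in> P i \<Longrightarrow> y \<in> P i \<Longrightarrow> \<kappa> x = \<kappa> y"
  unfolding separates_def by blast

lemma separatesD_neq:
  "separates \<kappa> P L \<Longrightarrow> i \<in> L \<Longrightarrow> i' \<in> L \<Longrightarrow> i \<noteq> i' \<Longrightarrow> x \<in> P i \<Longrightarrow> y \<in> P i' \<Longrightarrow> \<kappa> x \<noteq> \<kappa> y"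
  unfolding separates_def disjoint_family_on_def by blast

definition in_distinct_components :: "('i \<Rightarrow> 'a set) \<Rightarrow> 'i set \<Rightarrow> bool" where
  "in_distinct_components P L \<longleftrightarrow> (\<exists>\<kappa> :: 'a \<Rightarrow> nat. separates \<kappa> P L)"

lemma in_distinct_components_mono:
  assumes "in_distinct_components P L" and "\<And>i. Q i \<subseteq> P i" and "K \<subseteq> L"
  shows "in_distinct_components Q K"
proof -
  obtain \<kappa> :: "'b \<Rightarrow> nat" where "separates \<kappa> P L"
    using assms(1) unfolding in_distinct_components_def by blast
  then have "separates \<kappa> Q K"
    using assms(2,3) unfolding separates_def disjoint_family_on_def by blast
  then show ?thesis unfolding in_distinct_components_def by blast
qed

lemma in_distinct_components_empty: "in_distinct_components P {}"
  unfolding in_distinct_components_def separates_def disjoint_family_on_def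
  by (intro exI[of _ "\<lambda>_. 0"]) simp

lemma in_distinct_components_insert_empty:
  assumes "in_distinct_components P L" and "P i = {}"
  shows "in_distinct_components P (insert i L)"
  using assms unfolding in_distinct_components_def separates_def
  by (cases "i \<in> L") (simp_all add: insert_absorb disjoint_family_on_insert)

definition joins_distinct_components :: "('i \<Rightarrow> 'a::linorder set) \<Rightarrow> bool" where
  "joins_distinct_components P \<longleftrightarrow>
     (\<forall>w. in_distinct_components (\<lambda>i. P i \<inter> {..<w}) {i. w \<in> P i})"

definition add_node :: "'a \<Rightarrow> 'i set \<Rightarrow> ('i \<Rightarrow> 'a set) \<Rightarrow> 'i \<Rightarrow> 'a set" where
  "add_node w S P i = (if i \<in> S then insert w (P i) else P i)"

lemma joins_distinct_components_add_node:
  fixes P :: "'i \<Rightarrow> 'a::linorder set"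
  assumes joins: "joins_distinct_components P" and below: "\<And>i. P i \<subseteq> {..<w}"
    and distinct: "in_distinct_components P S"
  shows "joins_distinct_components (add_node w S P)"
  unfolding joins_distinct_components_def
proof
  fix u :: 'a
  consider "u < w" | "u = w" | "u > w" by fastforce
  then show "in_distinct_components (\<lambda>i. add_node w S P i \<inter> {..<u}) {i. u \<in> add_node w S P i}"
  proof cases
    case 1
    then have "add_node w S P i \<inter> {..<u} = P i \<inter> {..<u}" "u \<in> add_node w S P i \<longleftrightarrow> u \<in> P i" for i
      unfolding add_node_def by auto
    then show ?thesis using joins unfolding joins_distinct_components_def by simp
  next
    case 2
    then have "add_node w S P i \<inter> {..<u} = P i" "u \<in> add_node w S P i \<longleftrightarrow> i \<in> S" for i
      using below[of i] unfolding add_node_def by auto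
    then show ?thesis using distinct by simp
  next
    case 3
    then have "u \<notin> add_node w S P i" for i using below[of i] unfolding add_node_def by auto
    then show ?thesis by (simp add: in_distinct_components_empty)
  qed
qed

lemma in_distinct_components_add_node:
  fixes P :: "'i \<Rightarrow> 'a set"
  assumes distinct: "in_distinct_components P (L \<union> S)" and new: "\<And>i. w \<notin> P i" and r: "r \<in> S"
  shows "in_distinct_components (add_node w S P) (insert r (L - S))"
proof -
  obtain \<kappa> :: "'a \<Rightarrow> nat" where \<kappa>: "separates \<kappa> P (L \<union> S)"
    using distinct unfolding in_distinct_components_def by blast
  define joined where "joined = insert w {x. \<exists>i \<in> S. \<kappa> x \<in> \<kappa> ` P i}"
  define \<kappa>' where "\<kappa>' x = (if x \<in> joined then 0 else Suc (\<kappa> x))" for x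
  have joined_iff: "x \<in> joined \<longleftrightarrow> (\<exists>i \<in> S. \<kappa> x \<in> \<kappa> ` P i)" if "x \<in> P i" for x i
    using that new unfolding joined_def by auto
  have label_S: "\<kappa>' x = 0" if "i \<in> S" "x \<in> add_node w S P i" for i x
    using that unfolding \<kappa>'_def joined_def add_node_def by auto
  have label_L: "\<kappa>' x = Suc (\<kappa> x)" if "i \<in> L - S" "x \<in> P i" for i x
    using that separatesD_neq[OF \<kappa>, of i] unfolding \<kappa>'_def joined_iff[OF that(2)] by fastforce
  have "\<kappa>' x = \<kappa>' y" if "x \<in> add_node w S P i" "y \<in> add_node w S P i" for x y i
  proof (cases "i \<in> S")
    case True
    then show ?thesis using label_S that by metis
  next
    case False
    then have xy: "x \<in> P i" "y \<in> P i" using that unfolding add_node_def by simp_all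
    then show ?thesis
      using separatesD_eq[OF \<kappa> xy] joined_iff[OF xy(1)] joined_iff[OF xy(2)]
      unfolding \<kappa>'_def by simp
  qed
  moreover have "\<kappa>' x \<noteq> \<kappa>' y"
    if i: "i \<in> insert r (L - S)" "i' \<in> insert r (L - S)" "i \<noteq> i'"
      and xy: "x \<in> add_node w S P i" "y \<in> add_node w S P i'" for i i' x y
  proof -
    have "\<kappa>' x = (if i \<in> S then 0 else Suc (\<kappa> x))" "\<kappa>' y = (if i' \<in> S then 0 else Suc (\<kappa> y))"
      using i xy label_S[of i x] label_S[of i' y] label_L[of i x] label_L[of i' y] r
      by (auto simp: add_node_def)
    then show ?thesis
      using separatesD_neq[OF \<kappa>, of i i' x y] i xy r by (auto simp: add_node_def)
  qed
  ultimately have "separates \<kappa>' (add_node w S P) (insert r (L - S))"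
    unfolding separates_def disjoint_family_on_def by blast
  then show ?thesis unfolding in_distinct_components_def by blast
qed

section \<open>Hyperforests\<close>

definition adjacent :: "'a set set \<Rightarrow> 'a set \<Rightarrow> ('a \<times> 'a) set" where
  "adjacent E U = {(x, y). \<exists>e \<in> E. {x, y} \<subseteq> e \<inter> U}"

lemma hypercycle_walk:
  assumes cycle: "hypercycle E l v f" and "1 \<le> a" "a \<le> b" "b \<le> Suc l"
    and "\<And>t. a \<le> t \<Longrightarrow> t \<le> b \<Longrightarrow> v t \<in> U"
  shows "(v a, v b) \<in> (adjacent E U)\<^sup>*"
  using \<open>a \<le> b\<close>
proof (induction rule: dec_induct)
  case (step t)
  then have "f t \<in> E" "v t \<in> f t \<inter> U" "v (Suc t) \<in> f t \<inter> U"
    using assms unfolding hypercycle_def by auto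
  then have "(v t, v (Suc t)) \<in> adjacent E U" unfolding adjacent_def by auto
  then show ?case using step.IH by (rule rtrancl_into_rtrancl[rotated])
qed simp

lemma first_and_last_occurrence:
  fixes v :: "'i::linorder \<Rightarrow> 'a"
  assumes "finite I" "w \<in> v ` I"
  obtains t s where "t \<in> I" "s \<in> I" "v t = w" "v s = w"
    "\<And>u. u \<in> I \<Longrightarrow> u < t \<or> s < u \<Longrightarrow> v u \<noteq> w"
proof (rule that)
  define visits where "visits = {u \<in> I. v u = w}"
  have visits: "finite visits" "visits \<noteq> {}" using assms unfolding visits_def by auto
  show "Min visits \<in> I" "Max visits \<in> I" "v (Min visits) = w" "v (Max visits) = w"
    using Min_in[OF visits] Max_in[OF visits] unfolding visits_def by auto
  show "v u \<noteq> w" if "u \<in> I" "u < Min visits \<or> Max visits < u" for u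
  proof -
    have "u \<notin> visits"
      using that(2) Min_le[OF visits(1), of u] Max_ge[OF visits(1), of u] by (auto simp: not_le)
    then show ?thesis using that(1) unfolding visits_def by simp
  qed
qed

text \<open>The arc leads from the last visit to \<open>w\<close> in \<open>1, \<dots>, l\<close> cyclically to the next visit.\<close>

lemma hypercycle_arc:
  assumes cycle: "hypercycle E l v f" and w: "w \<in> v ` {1..l}"
  defines "U \<equiv> v ` {1..l} - {w}"
  obtains e e' x y where "e \<in> E" "e' \<in> E" "e \<noteq> e'" "w \<in> e" "w \<in> e'" "x \<in> e \<inter> U" "y \<in> e' \<inter> U"
    "(x, y) \<in> (adjacent E U)\<^sup>*"
proof -
  have closed: "v (Suc l) = v 1" and inj: "inj_on f {1..l}" and
    edge: "\<And>t. t \<in> {1..l} \<Longrightarrow> f t \<in> E \<and> v t \<in> f t \<and> v (Suc t) \<in> f t \<and> v t \<noteq> v (Suc t)"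
    using cycle unfolding hypercycle_def by auto
  obtain t' s where t': "t' \<in> {1..l}" "v t' = w" and s: "s \<in> {1..l}" "v s = w"
    and elsewhere: "\<And>u. u \<in> {1..l} \<Longrightarrow> u < t' \<or> s < u \<Longrightarrow> v u \<noteq> w"
    by (rule first_and_last_occurrence[OF finite_atLeastAtMost w]) blast
  have after: "v u \<in> U" if "s < u" "u \<le> l" for u
    using elsewhere[of u] that unfolding U_def by simp
  show thesis
  proof (cases "v 1 = w")
    case True
    then have "s \<noteq> l" using edge[of l] closed s by auto
    then have "s < l" using s(1) by simp
    show thesis
    proof (rule that[of "f s" "f l" "v (Suc s)" "v l"])
      show "f s \<noteq> f l" using inj_on_eq_iff[OF inj, of s l] s(1) \<open>s < l\<close> by simp
      show "(v (Suc s), v l) \<in> (adjacent E U)\<^sup>*"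
        using \<open>s < l\<close> after by (intro hypercycle_walk[OF cycle]) auto
    qed (use edge[of s] edge[of l] s closed True \<open>s < l\<close> after[of "Suc s"] after[of l] in auto)
  next
    case False
    then obtain t where t: "t' = Suc t" "t \<in> {1..l}"
      using t' by (cases t'; cases "t' = 1") auto
    have "t < s" using elsewhere[OF s(1)] s(2) t(1) by fastforce
    have before: "v u \<in> U" if "1 \<le> u" "u \<le> t" for u
      using elsewhere[of u] t that unfolding U_def by simp
    have after_closed: "v u \<in> U" if "s < u" "u \<le> Suc l" for u
      using that after[of u] closed before[of 1] t(2) by (cases "u = Suc l") auto
    show thesis
    proof (rule that[of "f s" "f t" "v (Suc s)" "v t"])
      show "f s \<noteq> f t" using inj_on_eq_iff[OF inj s(1) t(2)] \<open>t < s\<close> by simp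
      have "(v (Suc s), v (Suc l)) \<in> (adjacent E U)\<^sup>*"
        using s(1) after_closed by (intro hypercycle_walk[OF cycle]) auto
      also have "(v (Suc l), v t) \<in> (adjacent E U)\<^sup>*"
        unfolding closed using t(2) before by (intro hypercycle_walk[OF cycle]) auto
      finally show "(v (Suc s), v t) \<in> (adjacent E U)\<^sup>*" .
    qed (use edge[of s] edge[of t] s t t'(2) after_closed[of "Suc s"] before[of t] in auto)
  qed
qed

lemma hyperforest_if_joins_distinct_components:
  fixes P :: "'i \<Rightarrow> nat set"
  assumes joins: "joins_distinct_components P"
  shows "hyperforest (range P)"
  unfolding hyperforest_def
proof clarify
  fix l v f assume cycle: "hypercycle (range P) l v f"
  define w where "w = Max (v ` {1..l})"
  define U where "U = v ` {1..l} - {w}"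
  have "v ` {1..l} \<noteq> {}" using cycle unfolding hypercycle_def by auto
  then have "w \<in> v ` {1..l}" unfolding w_def by (intro Max_in) auto
  then obtain e e' x y where "e \<in> range P" "e' \<in> range P" "e \<noteq> e'" "w \<in> e" "w \<in> e'"
    and xy: "x \<in> e \<inter> U" "y \<in> e' \<inter> U" and arc: "(x, y) \<in> (adjacent (range P) U)\<^sup>*"
    unfolding U_def by (rule hypercycle_arc[OF cycle])
  then obtain i i' where i: "e = P i" "e' = P i'" "i \<noteq> i'" "w \<in> P i" "w \<in> P i'" by blast
  have below: "u < w" if "u \<in> U" for u
    using that unfolding U_def w_def
    by (metis Diff_iff Max_ge finite_atLeastAtMost finite_imageI insertCI le_neq_implies_less)
  obtain \<kappa> :: "nat \<Rightarrow> nat" where \<kappa>: "separates \<kappa> (\<lambda>i. P i \<inter> {..<w}) {i. w \<in> P i}"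
    using joins unfolding joins_distinct_components_def in_distinct_components_def by blast
  from arc have "\<kappa> x = \<kappa> y"
  proof (induction rule: rtrancl_induct)
    case (step z z')
    then obtain k where "z \<in> P k \<inter> {..<w}" "z' \<in> P k \<inter> {..<w}"
      using below unfolding adjacent_def by auto
    then show ?case using separatesD_eq[OF \<kappa>] step.IH by metis
  qed simp
  moreover have "\<kappa> x \<noteq> \<kappa> y"
    using i xy below by (intro separatesD_neq[OF \<kappa>, of i i']) auto
  ultimately show False by contradiction
qed

section \<open>Rainbow colorings\<close>

lemma recolor_avoiding:
  assumes \<kappa>: "separates \<kappa> P L" and range: "c \<in> V \<rightarrow> C" and inj: "\<And>i. inj_on c (P i)"
    and free: "\<And>i. i \<in> L \<Longrightarrow> \<not> C \<subseteq> c ` P i" and z: "z \<in> C"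
  obtains c' where "c' \<in> V \<rightarrow> C" "\<And>i. inj_on c' (P i)" "\<And>i. i \<in> L \<Longrightarrow> z \<notin> c' ` P i"
proof -
  have "\<exists>b \<in> C. \<forall>i \<in> L. a \<in> \<kappa> ` P i \<longrightarrow> b \<notin> c ` P i" for a
  proof (cases "\<exists>i \<in> L. a \<in> \<kappa> ` P i")
    case True
    then obtain i b where i: "i \<in> L" "a \<in> \<kappa> ` P i" and b: "b \<in> C" "b \<notin> c ` P i"
      using free by blast
    have "i' = i" if "i' \<in> L" "a \<in> \<kappa> ` P i'" for i'
      using separatesD_neq[OF \<kappa> that(1) i(1)] that(2) i(2) by blast
    then show ?thesis using b by blast
  qed (use z in blast)
  then obtain b where b: "\<And>a. b a \<in> C"
    and b_free: "\<And>i x. i \<in> L \<Longrightarrow> x \<in> P i \<Longrightarrow> b (\<kappa> x) \<notin> c ` P i"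
    by (metis imageI)
  define c' where "c' x = transpose z (b (\<kappa> x)) (c x)" for x
  show thesis
  proof
    show "c' \<in> V \<rightarrow> C"
      using range b z unfolding c'_def transpose_def by auto
    show "inj_on c' (P i)" for i
    proof (rule inj_onI)
      fix x y assume xy: "x \<in> P i" "y \<in> P i" "c' x = c' y"
      then have "c x = c y"
        using separatesD_eq[OF \<kappa> xy(1,2)] unfolding c'_def by (metis transpose_involutory)
      then show "x = y" using inj_onD[OF inj] xy by blast
    qed
    show "z \<notin> c' ` P i" if "i \<in> L" for i
    proof
      assume "z \<in> c' ` P i"
      then obtain x where x: "x \<in> P i" "transpose z (b (\<kappa> x)) (c x) = z" unfolding c'_def by auto
      then have "c x = b (\<kappa> x)" by (metis transpose_apply_first transpose_involutory)
      then show False using b_free[OF that x(1)] x(1) by (metis imageI)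
    qed
  qed
qed

lemma rainbow_coloring:
  fixes P :: "'i \<Rightarrow> 'a::linorder set" and C :: "'c set"
  assumes joins: "joins_distinct_components P" and C: "C \<noteq> {}"
    and "finite V" and "\<And>i. card (P i \<inter> V) \<le> card C"
  shows "\<exists>c \<in> V \<rightarrow> C. \<forall>i. inj_on c (P i \<inter> V)"
  using assms(3,4)
proof (induction V rule: finite_linorder_max_induct)
  case empty
  then show ?case by simp
next
  case (insert w V)
  have w: "w \<notin> V" using insert.hyps(2) by blast
  have "card (P i \<inter> V) \<le> card C" for i
    using insert.prems[of i] insert.hyps(1)
    by (meson Int_mono card_mono finite_Int finite_insert order_refl order_trans subset_insertI)
  then obtain c where c: "c \<in> V \<rightarrow> C" "\<And>i. inj_on c (P i \<inter> V)" using insert.IH by blast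
  have "in_distinct_components (\<lambda>i. P i \<inter> {..<w}) {i. w \<in> P i}"
    using joins unfolding joins_distinct_components_def by blast
  then have "in_distinct_components (\<lambda>i. P i \<inter> V) {i. w \<in> P i}"
    by (rule in_distinct_components_mono) (use insert.hyps(2) in auto)
  then obtain \<kappa> :: "'a \<Rightarrow> nat" where \<kappa>: "separates \<kappa> (\<lambda>i. P i \<inter> V) {i. w \<in> P i}"
    unfolding in_distinct_components_def by blast
  have free: "\<not> C \<subseteq> c ` (P i \<inter> V)" if "i \<in> {i. w \<in> P i}" for i
  proof
    assume "C \<subseteq> c ` (P i \<inter> V)"
    then have "card C \<le> card (P i \<inter> V)" using insert.hyps(1) by (intro surj_card_le) auto
    also have "\<dots> < card (P i \<inter> insert w V)"
      using that w insert.hyps(1) by (intro psubset_card_mono) auto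
    finally show False using insert.prems[of i] by simp
  qed
  obtain z where z: "z \<in> C" using C by blast
  obtain c' where c': "c' \<in> V \<rightarrow> C" "\<And>i. inj_on c' (P i \<inter> V)"
      "\<And>i. w \<in> P i \<Longrightarrow> z \<notin> c' ` (P i \<inter> V)"
    using recolor_avoiding[OF \<kappa> c free z] by auto
  have "inj_on (c'(w := z)) (P i \<inter> insert w V)" for i
    using c'(2,3)[of i] w by (cases "w \<in> P i") (auto simp: inj_on_def)
  moreover have "c'(w := z) \<in> insert w V \<rightarrow> C" using c'(1) z by auto
  ultimately show ?case by blast
qed

section \<open>The counting argument\<close>

text \<open>
  The relation \<open>reachable j n\<close> says that \<open>j\<close> nodes suffice for a stock of \<open>n a t\<close> hyperedges of
  color \<open>a\<close> and size \<open>t\<close>. Revealing a node costs one hyperedge of size \<open>k a\<close> of every color \<open>a\<close>,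
  where those of size \<open>0\<close> are free, and yields one of size \<open>k b + 1\<close> of some color \<open>b\<close>.
\<close>

locale stock_game =
  fixes C :: "'c set" and m :: nat and reachable :: "nat \<Rightarrow> ('c \<Rightarrow> nat \<Rightarrow> nat) \<Rightarrow> bool"
  assumes colors: "finite C" "C \<noteq> {}"
    and reveal_node:
      "\<lbrakk>reachable j n; \<And>a. a \<in> C \<Longrightarrow> k a < m; \<And>a. a \<in> C \<Longrightarrow> 0 < k a \<Longrightarrow> 0 < n a (k a)\<rbrakk> \<Longrightarrow>
      \<exists>b \<in> C. \<exists>n'. reachable (Suc j) n' \<and>
        (\<forall>a \<in> C. \<forall>t. n a t + of_bool (a = b \<and> t = Suc (k b)) \<le> n' a t + of_bool (t = k a))"
begin

lemma reveal_nodes: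
  assumes "reachable j n" and small: "\<And>a. a \<in> C \<Longrightarrow> k a < m"
    and "\<And>a. a \<in> C \<Longrightarrow> 0 < k a \<Longrightarrow> X + T \<le> n a (k a)"
  shows "\<exists>n'. reachable (j + T) n' \<and> (\<forall>a \<in> C. 0 < k a \<longrightarrow> X \<le> n' a (k a)) \<and>
    T \<le> (\<Sum>a \<in> C. n' a (Suc (k a)))"
  using assms(3)
proof (induction T arbitrary: X)
  case 0
  then show ?case using assms(1) by auto
next
  case (Suc T)
  then have "\<And>a. a \<in> C \<Longrightarrow> 0 < k a \<Longrightarrow> Suc X + T \<le> n a (k a)" by simp
  from Suc.IH[OF this] obtain n'
    where n': "reachable (j + T) n'" "T \<le> (\<Sum>a \<in> C. n' a (Suc (k a)))"
      and stock: "\<And>a. a \<in> C \<Longrightarrow> 0 < k a \<Longrightarrow> Suc X \<le> n' a (k a)"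
    by blast
  have "0 < n' a (k a)" if "a \<in> C" "0 < k a" for a using stock[OF that] by simp
  then obtain b n'' where b: "b \<in> C" and n'': "reachable (Suc (j + T)) n''" and
    change: "\<And>a t. a \<in> C \<Longrightarrow>
      n' a t + of_bool (a = b \<and> t = Suc (k b)) \<le> n'' a t + of_bool (t = k a)"
    using reveal_node[OF n'(1), of k, OF small] by blast
  have "X \<le> n'' a (k a)" if "a \<in> C" "0 < k a" for a
    using change[OF that(1), of "k a"] stock[OF that] by simp
  moreover have "Suc T \<le> (\<Sum>a \<in> C. n'' a (Suc (k a)))"
  proof -
    have "Suc T \<le> (\<Sum>a \<in> C. n' a (Suc (k a))) + (\<Sum>a \<in> C. of_bool (a = b))"
      using n'(2) b colors(1) by (simp add: of_bool_def)
    also have "\<dots> = (\<Sum>a \<in> C. n' a (Suc (k a)) + of_bool (a = b))"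
      by (rule sum.distrib[symmetric])
    also have "\<dots> \<le> (\<Sum>a \<in> C. n'' a (Suc (k a)))"
    proof (rule sum_mono)
      fix a assume "a \<in> C"
      then show "n' a (Suc (k a)) + of_bool (a = b) \<le> n'' a (Suc (k a))"
        using change[of a "Suc (k a)"] by (cases "a = b") auto
    qed
    finally show ?thesis .
  qed
  ultimately show ?case using n'' by auto
qed

lemma raise_size:
  assumes "reachable j n" "\<And>a. a \<in> C \<Longrightarrow> k a < m"
    and "\<And>a. a \<in> C \<Longrightarrow> 0 < k a \<Longrightarrow> Suc (card C) * X \<le> n a (k a)"
  shows "\<exists>b \<in> C. \<exists>n'. reachable (j + card C * X) n' \<and>
    (\<forall>a \<in> C. 0 < (k(b := Suc (k b))) a \<longrightarrow> X \<le> n' a ((k(b := Suc (k b))) a))"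
proof -
  have "\<And>a. a \<in> C \<Longrightarrow> 0 < k a \<Longrightarrow> X + card C * X \<le> n a (k a)" using assms(3) by simp
  from reveal_nodes[OF assms(1,2) this] obtain n' where n': "reachable (j + card C * X) n'"
    "\<forall>a \<in> C. 0 < k a \<longrightarrow> X \<le> n' a (k a)" "card C * X \<le> (\<Sum>a \<in> C. n' a (Suc (k a)))"
    by blast
  have "\<exists>b \<in> C. X \<le> n' b (Suc (k b))"
  proof (rule ccontr)
    assume "\<not> ?thesis"
    then have "(\<Sum>a \<in> C. n' a (Suc (k a))) < (\<Sum>a \<in> C. X)"
      using colors by (intro sum_strict_mono) (auto simp: not_le)
    then show False using n'(3) by simp
  qed
  then show ?thesis using n'(1,2) by fastforce
qed

lemma reach_size:
  assumes "reachable j n" "\<And>a. a \<in> C \<Longrightarrow> k a < m"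
    and "\<And>a. a \<in> C \<Longrightarrow> 0 < k a \<Longrightarrow> Suc (card C) ^ s \<le> n a (k a)"
    and "card C * (m - 1) < s + (\<Sum>a \<in> C. k a)"
  shows "\<exists>j' \<le> j + Suc (card C) ^ s. \<exists>n'. reachable j' n' \<and> (\<exists>a \<in> C. 0 < n' a m)"
  using assms
proof (induction s arbitrary: j n k)
  case 0
  have "k a \<le> m - 1" if "a \<in> C" for a using 0(2)[OF that] by simp
  then have "(\<Sum>a \<in> C. k a) \<le> card C * (m - 1)" using sum_bounded_above[of C k "m - 1"] by simp
  then show ?case using 0(4) by simp
next
  case (Suc s)
  define X where "X = Suc (card C) ^ s"
  have X: "0 < X" "Suc (card C) ^ Suc s = X + card C * X" unfolding X_def by simp_all
  obtain b n' where b: "b \<in> C" and n': "reachable (j + card C * X) n'" and stock: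
    "\<And>a. a \<in> C \<Longrightarrow> 0 < (k(b := Suc (k b))) a \<Longrightarrow> X \<le> n' a ((k(b := Suc (k b))) a)"
    using raise_size[OF Suc.prems(1), of k X, OF Suc.prems(2)] Suc.prems(3)
    unfolding X_def power_Suc by blast
  show ?case
  proof (cases "Suc (k b) = m")
    case True
    then have "0 < n' b m" using stock[OF b] X(1) by simp
    then show ?thesis
      using n' b unfolding X by (intro exI[of _ "j + card C * X"]) auto
  next
    case False
    have "(k(b := Suc (k b))) a < m" if "a \<in> C" for a
      using Suc.prems(2)[OF that] False by auto
    moreover have "(\<Sum>a \<in> C. (k(b := Suc (k b))) a) = Suc (\<Sum>a \<in> C. k a)"
      using b colors(1) by (simp add: sum.remove[of _ b])
    ultimately obtain j' where "j' \<le> j + card C * X + X"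
      "\<exists>n'. reachable j' n' \<and> (\<exists>a \<in> C. 0 < n' a m)"
      using Suc.IH[OF n', of "k(b := Suc (k b))"] stock Suc.prems(4) unfolding X_def by auto
    then show ?thesis unfolding X by (intro exI[of _ j']) simp
  qed
qed

end

section \<open>The adversary\<close>

text \<open>
  The hyperedge \<open>P i\<close> is opened by the node \<open>i + 1\<close>, so that the number of hyperedges reveals
  nothing but the number of nodes. The hyperedges in \<open>L\<close> can still be joined.
\<close>

definition position :: "nat \<Rightarrow> nat \<Rightarrow> (nat \<Rightarrow> nat set) \<Rightarrow> nat set \<Rightarrow> bool" where
  "position m j P L \<longleftrightarrow>
     (\<forall>i. P i \<subseteq> {Suc i..j} \<and> card (P i) \<le> m) \<and> (\<forall>i < j. Suc i \<in> P i) \<and>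
     joins_distinct_components P \<and> in_distinct_components P L \<and> L \<subseteq> {..<j}"

definition play :: "online_alg \<Rightarrow> nat \<Rightarrow> (nat \<Rightarrow> nat set) \<Rightarrow> nat \<Rightarrow> nat" where
  "play A N P = online_coloring A (map P [0..<N])"

definition mono_edges ::
    "(nat \<Rightarrow> nat) \<Rightarrow> (nat \<Rightarrow> nat set) \<Rightarrow> nat set \<Rightarrow> nat \<Rightarrow> nat \<Rightarrow> nat set" where
  "mono_edges c P L a t = {i \<in> L. card (P i) = t \<and> c ` P i \<subseteq> {a}}"

lemma position_empty: "position m 0 (\<lambda>_. {}) {}"
  unfolding position_def joins_distinct_components_def
  by (simp add: in_distinct_components_empty)

lemma position_add_node:
  assumes pos: "position m j P L" and m: "0 < m" and S: "j \<in> S" "S \<subseteq> insert j L" and r: "r \<in> S"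
    and small: "\<And>i. i \<in> S \<Longrightarrow> card (P i) < m"
  shows "position m (Suc j) (add_node (Suc j) S P) (insert r (L - S))"
proof -
  have P: "\<And>i. P i \<subseteq> {Suc i..j}" "\<And>i. card (P i) \<le> m" "\<And>i. i < j \<Longrightarrow> Suc i \<in> P i"
    and joins: "joins_distinct_components P" and L: "in_distinct_components P L" "L \<subseteq> {..<j}"
    using pos unfolding position_def by auto
  have "P j = {}" using P(1)[of j] by auto
  then have jL: "in_distinct_components P (insert j L)"
    using L(1) by (intro in_distinct_components_insert_empty)
  have "joins_distinct_components (add_node (Suc j) S P)"
  proof (rule joins_distinct_components_add_node[OF joins])
    show "P i \<subseteq> {..<Suc j}" for i using P(1)[of i] by auto
    show "in_distinct_components P S"
      using jL by (rule in_distinct_components_mono) (use S(2) in auto)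
  qed
  moreover have "in_distinct_components (add_node (Suc j) S P) (insert r (L - S))"
  proof (rule in_distinct_components_add_node[OF _ _ r])
    show "in_distinct_components P (L \<union> S)"
      using jL by (rule in_distinct_components_mono) (use S in auto)
    show "Suc j \<notin> P i" for i using P(1)[of i] by auto
  qed
  moreover have "i \<le> j" if "i \<in> S" for i using that S(2) L(2) by auto
  then have "add_node (Suc j) S P i \<subseteq> {Suc i..Suc j}" for i
    using P(1)[of i] unfolding add_node_def by auto
  moreover have "card (add_node (Suc j) S P i) \<le> m" for i
    using card_insert_le_m1[OF m, of "P i" "Suc j"] small[of i] P(2)[of i]
    unfolding add_node_def by auto
  moreover have "Suc i \<in> add_node (Suc j) S P i" if "i < Suc j" for i
    using that P(3)[of i] S(1) unfolding add_node_def by (cases "i = j") auto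
  moreover have "insert r (L - S) \<subseteq> {..<Suc j}" using r S(2) L(2) by auto
  ultimately show ?thesis unfolding position_def by blast
qed

lemma play_add_node: "x < w \<Longrightarrow> play A N (add_node w S P) x = play A N P x"
proof -
  assume "x < w"
  then have "add_node w S P i \<inter> {1..x} = P i \<inter> {1..x}" for i unfolding add_node_def by auto
  then show ?thesis unfolding play_def online_coloring_def by (simp add: comp_def)
qed

lemma mono_edges_add_node_untouched:
  assumes "\<And>x. x < w \<Longrightarrow> c' x = c x" and "\<And>i. P i \<subseteq> {..<w}"
  shows "mono_edges c P L a t - S \<subseteq> mono_edges c' (add_node w S P) (insert r (L - S)) a t"
proof
  fix i assume i: "i \<in> mono_edges c P L a t - S"
  have "c' ` P i = c ` P i" using assms(1) assms(2)[of i] by (intro image_cong) auto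
  then show "i \<in> mono_edges c' (add_node w S P) (insert r (L - S)) a t"
    using i unfolding mono_edges_def add_node_def by simp
qed

lemma mono_edges_add_node_grown:
  assumes "\<And>x. x < w \<Longrightarrow> c' x = c x" and "P r \<subseteq> {..<w}" and "finite (P r)"
    and "r \<in> S" and "r \<in> mono_edges c P K (c' w) t"
  shows "r \<in> mono_edges c' (add_node w S P) (insert r (L - S)) (c' w) (Suc t)"
proof -
  have "w \<notin> P r" "c' ` P r = c ` P r" using assms(1,2) by (auto intro!: image_cong)
  then show ?thesis using assms(3-5) unfolding mono_edges_def add_node_def by simp
qed

lemma mono_edges_Int_chosen:
  assumes pos: "position m j P L" and s: "\<And>a. a \<in> C \<Longrightarrow> s a \<in> mono_edges c P (insert j L) a (k a)"
    and "a \<in> C"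
  shows "mono_edges c P L a t \<inter> insert j (s ` C) \<subseteq> (if t = k a then {s a} else {})"
proof
  fix i assume i: "i \<in> mono_edges c P L a t \<inter> insert j (s ` C)"
  then have "i < j" "Suc i \<in> P i" using pos unfolding mono_edges_def position_def by auto
  then obtain a' where a': "a' \<in> C" "i = s a'" using i by auto
  then have "card (P i) = k a'" "c (Suc i) = a'" "card (P i) = t" "c (Suc i) = a"
    using i s[OF a'(1)] \<open>Suc i \<in> P i\<close> unfolding mono_edges_def by auto
  then show "i \<in> (if t = k a then {s a} else {})" using a'(2) by simp
qed

lemma card_mono_edges_add_node:
  assumes pos: "position m j P L" and s: "\<And>a. a \<in> C \<Longrightarrow> s a \<in> mono_edges c P (insert j L) a (k a)"
    and old: "\<And>x. x < Suc j \<Longrightarrow> c' x = c x" and b: "c' (Suc j) = b" "b \<in> C" and a: "a \<in> C"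
  defines "S \<equiv> insert j (s ` C)"
  shows "card (mono_edges c P L a t) + of_bool (a = b \<and> t = Suc (k b)) \<le>
    card (mono_edges c' (add_node (Suc j) S P) (insert (s b) (L - S)) a t) + of_bool (t = k a)"
proof -
  let ?M = "mono_edges c P L a t"
    and ?M' = "mono_edges c' (add_node (Suc j) S P) (insert (s b) (L - S)) a t"
  define G where "G = (if a = b \<and> t = Suc (k b) then {s b} else {})"
  have P: "P i \<subseteq> {..<Suc j}" "finite (P i)" for i
    using pos finite_subset[of "P i" "{Suc i..j}"] unfolding position_def by fastforce+
  have "finite L" using pos finite_subset unfolding position_def by blast
  then have finite: "finite ?M" "finite ?M'" unfolding mono_edges_def by simp_all
  have "s b \<in> S" using b(2) unfolding S_def by blast
  then have "G \<subseteq> ?M'"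
    using mono_edges_add_node_grown[OF old P \<open>s b \<in> S\<close>, where L = L] s[OF b(2)] b(1)
    unfolding G_def by auto
  moreover have "?M - S \<subseteq> ?M'"
    using old P(1) by (rule mono_edges_add_node_untouched)
  ultimately have "card ((?M - S) \<union> G) \<le> card ?M'" using finite by (intro card_mono) auto
  moreover have "card ((?M - S) \<union> G) = card (?M - S) + of_bool (a = b \<and> t = Suc (k b))"
    using finite \<open>s b \<in> S\<close> unfolding G_def by (subst card_Un_disjoint) auto
  moreover have "card (?M \<inter> S) \<le> of_bool (t = k a)"
    using card_mono[OF _ mono_edges_Int_chosen[OF pos s a, of t]] unfolding S_def by auto
  moreover have "card ?M = card (?M \<inter> S) + card (?M - S)"
    using finite by (metis card_Int_Diff)
  ultimately show ?thesis by linarith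
qed

lemma position_reveal_node:
  assumes alg: "online_algorithm m A" and pos: "position m j P L"
    and k: "\<And>a. a \<in> {1..m} \<Longrightarrow> k a < m"
    and stock: "\<And>a. a \<in> {1..m} \<Longrightarrow> 0 < k a \<Longrightarrow> mono_edges (play A N P) P L a (k a) \<noteq> {}"
  shows "\<exists>b \<in> {1..m}. \<exists>P' L'. position m (Suc j) P' L' \<and> (\<forall>a \<in> {1..m}. \<forall>t.
    card (mono_edges (play A N P) P L a t) + of_bool (a = b \<and> t = Suc (k b)) \<le>
    card (mono_edges (play A N P') P' L' a t) + of_bool (t = k a))"
proof -
  let ?c = "play A N P"
  have "P j = {}" using pos unfolding position_def by force
  then have "\<exists>i. i \<in> mono_edges ?c P (insert j L) a (k a)" if "a \<in> {1..m}" for a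
    using stock[OF that] unfolding mono_edges_def by (cases "k a = 0") auto
  then obtain s where s: "\<And>a. a \<in> {1..m} \<Longrightarrow> s a \<in> mono_edges ?c P (insert j L) a (k a)" by metis
  define S where "S = insert j (s ` {1..m})"
  define P' where "P' = add_node (Suc j) S P"
  define b where "b = play A N P' (Suc j)"
  define L' where "L' = insert (s b) (L - S)"
  have b: "b \<in> {1..m}"
    using alg unfolding b_def play_def online_coloring_def online_algorithm_def by blast
  have "position m (Suc j) P' L'"
    unfolding P'_def L'_def
  proof (rule position_add_node[OF pos])
    show "0 < m" using b by simp
    show "S \<subseteq> insert j L" using s unfolding S_def mono_edges_def by blast
    show "card (P i) < m" if "i \<in> S" for i
      using that s k b \<open>P j = {}\<close> unfolding S_def mono_edges_def by auto
  qed (use b in \<open>auto simp: S_def\<close>)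
  moreover have "card (mono_edges ?c P L a t) + of_bool (a = b \<and> t = Suc (k b)) \<le>
      card (mono_edges (play A N P') P' L' a t) + of_bool (t = k a)" if "a \<in> {1..m}" for a t
    unfolding P'_def L'_def S_def
    by (rule card_mono_edges_add_node[OF pos s play_add_node _ b that])
      (simp_all add: b_def P'_def S_def)
  ultimately show ?thesis using b by blast
qed

lemma mono_edge_persists:
  assumes m: "0 < m" and pos: "position m j P L" and "mono_edges (play A N P) P L a t \<noteq> {}"
  shows "\<exists>P' L'. position m (j + d) P' L' \<and> mono_edges (play A N P') P' L' a t \<noteq> {}"
proof (induction d)
  case 0
  then show ?case using assms by auto
next
  case (Suc d)
  then obtain P' L' where pos': "position m (j + d) P' L'"
    and mono: "mono_edges (play A N P') P' L' a t \<noteq> {}" by blast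
  let ?w = "Suc (j + d)"
  let ?P = "add_node ?w {j + d} P'" and ?L = "insert (j + d) (L' - {j + d})"
  have P': "P' i \<subseteq> {..<?w}" "P' (j + d) = {}" "L' \<subseteq> {..<j + d}" for i
    using pos' unfolding position_def by force+
  then have "mono_edges (play A N P') P' L' a t - {j + d} \<subseteq> mono_edges (play A N ?P) ?P ?L a t"
    by (intro mono_edges_add_node_untouched play_add_node) auto
  moreover have "j + d \<notin> mono_edges (play A N P') P' L' a t"
    using P'(3) unfolding mono_edges_def by auto
  moreover have "position m ?w ?P ?L"
    using P'(2) m by (intro position_add_node[OF pos' m]) auto
  ultimately show ?case using mono by fastforce
qed

definition reachable_stock ::
    "online_alg \<Rightarrow> nat \<Rightarrow> nat \<Rightarrow> nat \<Rightarrow> (nat \<Rightarrow> nat \<Rightarrow> nat) \<Rightarrow> bool" where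
  "reachable_stock A m N j n \<longleftrightarrow>
     (\<exists>P L. position m j P L \<and> n = (\<lambda>a t. card (mono_edges (play A N P) P L a t)))"

lemma stock_game_reachable_stock:
  assumes alg: "online_algorithm m A"
  shows "stock_game {1..m} m (reachable_stock A m N)"
proof
  show "{1..m} \<noteq> {}" using alg unfolding online_algorithm_def by blast
next
  fix j n and k :: "nat \<Rightarrow> nat"
  assume "reachable_stock A m N j n"
  then obtain P L where pos: "position m j P L"
    and n: "n = (\<lambda>a t. card (mono_edges (play A N P) P L a t))"
    unfolding reachable_stock_def by blast
  assume small: "\<And>a. a \<in> {1..m} \<Longrightarrow> k a < m" and "\<And>a. a \<in> {1..m} \<Longrightarrow> 0 < k a \<Longrightarrow> 0 < n a (k a)"
  then have "\<And>a. a \<in> {1..m} \<Longrightarrow> 0 < k a \<Longrightarrow> mono_edges (play A N P) P L a (k a) \<noteq> {}"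
    unfolding n by (metis card.empty less_irrefl)
  from position_reveal_node[OF alg pos small this]
  show "\<exists>b \<in> {1..m}. \<exists>n'. reachable_stock A m N (Suc j) n' \<and>
    (\<forall>a \<in> {1..m}. \<forall>t. n a t + of_bool (a = b \<and> t = Suc (k b)) \<le> n' a t + of_bool (t = k a))"
    unfolding n reachable_stock_def by fast
qed simp

lemma exists_position_with_full_mono_edge:
  assumes alg: "online_algorithm m A" and N: "N = (m + 1) ^ (m * (m - 1) + 1)"
  obtains P L a where "position m N P L" "a \<in> {1..m}" "mono_edges (play A N P) P L a m \<noteq> {}"
proof -
  interpret stock_game "{1..m}" m "reachable_stock A m N"
    using alg by (rule stock_game_reachable_stock)
  have m: "0 < m" using colors(2) by simp
  obtain n where "reachable_stock A m N 0 n"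
    using position_empty unfolding reachable_stock_def by blast
  from reach_size[OF this, of "\<lambda>_. 0" "m * (m - 1) + 1"] obtain j n a
    where j: "j \<le> N" and reachable: "reachable_stock A m N j n" and a: "a \<in> {1..m}" "0 < n a m"
    using m unfolding N by auto
  then obtain P L where pos: "position m j P L" and "mono_edges (play A N P) P L a m \<noteq> {}"
    unfolding reachable_stock_def by force
  from mono_edge_persists[OF m this, of "N - j"] show thesis using that j a(1) by auto
qed

section \<open>Makespans\<close>

lemma makespan_ge:
  assumes "finite E" "e \<in> E" "i \<in> {1..m}"
  shows "card (c -` {i} \<inter> e) \<le> makespan m E c"
proof -
  have "card (c -` {i} \<inter> e) \<le> (SUP e \<in> E. card (c -` {i} \<inter> e))"
    using assms by (intro cSUP_upper bdd_above_finite) auto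
  also have "\<dots> \<le> makespan m E c"
    unfolding makespan_def using assms by (intro cSUP_upper bdd_above_finite) auto
  finally show ?thesis .
qed

lemma makespan_le:
  assumes "1 \<le> m" "E \<noteq> {}" "\<And>i e. i \<in> {1..m} \<Longrightarrow> e \<in> E \<Longrightarrow> card (c -` {i} \<inter> e) \<le> b"
  shows "makespan m E c \<le> b"
  unfolding makespan_def using assms by (intro cSUP_least) auto

lemma card_vimage_singleton_Int_le_1: "inj_on c e \<Longrightarrow> card (c -` {i} \<inter> e) \<le> 1"
  using card_vimage_inj_on_le[of c e "{i}"] by simp

lemma opt_makespan_le_makespan:
  assumes "\<And>e. e \<in> E \<Longrightarrow> e \<subseteq> {1..n}" and c: "c \<in> {1..n} \<rightarrow> {1..m}"
  shows "opt_makespan m n E \<le> makespan m E c"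
proof -
  have "restrict c {1..n} -` {i} \<inter> e = c -` {i} \<inter> e" if "e \<in> E" for i e
    using assms(1)[OF that] by auto
  then have "makespan m E (restrict c {1..n}) = makespan m E c"
    unfolding makespan_def by (intro SUP_cong) auto
  moreover have "restrict c {1..n} \<in> {1..n} \<rightarrow>\<^sub>E {1..m}" using c by (auto simp: restrict_PiE_iff)
  ultimately show ?thesis
    unfolding opt_makespan_def
    by (metis Min_le finite_PiE finite_atLeastAtMost finite_imageI imageI)
qed

section \<open>Hard instances\<close>

lemma position_instance:
  assumes m: "1 \<le> m" and N: "1 \<le> N" and pos: "position m N P L"
  defines "es \<equiv> map P [0..<N]"
  shows "hypergraph N es" "hyperforest (set es)" "\<forall>e \<in> set es. card e \<le> m"
    "opt_makespan m N (set es) \<le> 1"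
proof -
  have P: "\<And>i. P i \<subseteq> {Suc i..N}" "\<And>i. card (P i) \<le> m" "\<And>i. i < N \<Longrightarrow> Suc i \<in> P i"
    and joins: "joins_distinct_components P"
    using pos unfolding position_def by auto
  have es: "set es = P ` {0..<N}" unfolding es_def by simp
  have within: "e \<subseteq> {1..N}" if "e \<in> set es" for e
    using that P(1) unfolding es by fastforce
  have "inj_on P {0..<N}"
  proof (rule inj_onI)
    fix i i' assume "i \<in> {0..<N}" "i' \<in> {0..<N}" "P i = P i'"
    then have "Suc i \<in> P i'" "Suc i' \<in> P i" using P(3) by auto
    then show "i = i'" using P(1)[of i] P(1)[of i'] by fastforce
  qed
  then show "hypergraph N es"
    using within unfolding hypergraph_def es_def by (simp add: distinct_map)
  have "hyperforest (range P)" using joins by (rule hyperforest_if_joins_distinct_components)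
  then show "hyperforest (set es)" unfolding hyperforest_def hypercycle_def es by blast
  show "\<forall>e \<in> set es. card e \<le> m" using P(2) unfolding es by blast
  have "P i \<inter> {1..N} = P i" for i using P(1)[of i] by auto
  then obtain c where c: "c \<in> {1..N} \<rightarrow> {1..m}" "\<And>i. inj_on c (P i)"
    using rainbow_coloring[OF joins, of "{1..m}" "{1..N}"] P(2) m by auto
  have "opt_makespan m N (set es) \<le> makespan m (set es) c"
    using within c(1) by (rule opt_makespan_le_makespan)
  also have "\<dots> \<le> 1"
    using m N c(2) unfolding es
    by (intro makespan_le) (auto simp del: One_nat_def intro: card_vimage_singleton_Int_le_1)
  finally show "opt_makespan m N (set es) \<le> 1" .
qed

lemma exists_hard_instance:
  assumes alg: "online_algorithm m A" and N: "N = (m + 1) ^ (m * (m - 1) + 1)"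
  obtains es where "hypergraph N es" "hyperforest (set es)" "\<forall>e \<in> set es. card e \<le> m"
    "opt_makespan m N (set es) \<le> 1" "m \<le> makespan m (set es) (online_coloring A es)"
proof -
  obtain P L a where pos: "position m N P L" and a: "a \<in> {1..m}"
    and "mono_edges (play A N P) P L a m \<noteq> {}"
    by (rule exists_position_with_full_mono_edge[OF alg N])
  then obtain i where i: "i \<in> L" "card (P i) = m" "play A N P ` P i \<subseteq> {a}"
    unfolding mono_edges_def by blast
  let ?es = "map P [0..<N]"
  have "P i \<in> set ?es" using i(1) pos unfolding position_def by auto
  then have "card (online_coloring A ?es -` {a} \<inter> P i) \<le>
      makespan m (set ?es) (online_coloring A ?es)"
    using a by (intro makespan_ge) auto
  moreover have "online_coloring A ?es -` {a} \<inter> P i = P i" using i(3) unfolding play_def by blast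
  ultimately have "m \<le> makespan m (set ?es) (online_coloring A ?es)" using i(2) by simp
  moreover have "1 \<le> m" using a by simp
  moreover have "1 \<le> N" unfolding N by (rule one_le_power) simp
  ultimately show thesis using that[of ?es] position_instance[OF _ _ pos] by blast
qed

lemma tower_mono: "2 \<le> x \<Longrightarrow> h \<le> h' \<Longrightarrow> tower x h \<le> tower x h'"
  by (rule lift_Suc_mono_le[of "tower x"]) simp_all

lemma instance_size_le_tower:
  assumes "1 \<le> m"
  shows "(m + 1) ^ (m * (m - 1) + 1) \<le> tower (2 * m + 1) 5"
proof -
  define x where "x = 2 * m + 1"
  have x: "2 \<le> x" using assms unfolding x_def by simp
  have "m * (m - 1) + 1 \<le> m * m" using assms by (cases m) auto
  also have "\<dots> \<le> x ^ 2" unfolding power2_eq_square x_def by (intro mult_mono) auto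
  also have "\<dots> \<le> x ^ x" using x by (intro power_increasing) auto
  also have "\<dots> = tower x 2" by (simp add: numeral_2_eq_2)
  also have "\<dots> \<le> tower x 4" using x by (rule tower_mono) simp
  finally have exponent: "m * (m - 1) + 1 \<le> tower x 4" .
  have "(m + 1) ^ (m * (m - 1) + 1) \<le> x ^ (m * (m - 1) + 1)"
    unfolding x_def by (intro power_mono) auto
  also have "\<dots> \<le> x ^ tower x 4" using exponent x by (intro power_increasing) auto
  also have "\<dots> = tower x 5" by (simp add: eval_nat_numeral)
  finally show ?thesis unfolding x_def .
qed

theorem mainTheorem11:
  fixes m :: nat
  assumes "m \<ge> 1"
  shows "\<exists>N. N \<le> tower (2 * m + 1) 5 \<and>
           (\<forall>\<epsilon>::real. \<epsilon> > 0 \<longrightarrow>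
              \<not> (\<exists>A. online_algorithm m A \<and>
                     competitive_on
                       {(n, es). n = N \<and> hypergraph n es \<and> hyperforest (set es) \<and>
                                 (\<forall>e \<in> set es. card e \<le> m)}
                       m (real m - \<epsilon>) A))"
proof -
  let ?N = "(m + 1) ^ (m * (m - 1) + 1)"
  have False if "\<epsilon> > 0" and alg: "online_algorithm m A" and competitive: "competitive_on
      {(n, es). n = ?N \<and> hypergraph n es \<and> hyperforest (set es) \<and> (\<forall>e \<in> set es. card e \<le> m)}
      m (real m - \<epsilon>) A" for \<epsilon> :: real and A
  proof -
    obtain es where es: "hypergraph ?N es" "hyperforest (set es)" "\<forall>e \<in> set es. card e \<le> m"
      and opt: "opt_makespan m ?N (set es) \<le> 1"
      and "m \<le> makespan m (set es) (online_coloring A es)"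
      by (rule exists_hard_instance[OF alg refl])
    then have "real m \<le> real (makespan m (set es) (online_coloring A es))" by simp
    also have "\<dots> \<le> (real m - \<epsilon>) * real (opt_makespan m ?N (set es))"
      using competitive es unfolding competitive_on_def by blast
    finally have ratio: "real m \<le> (real m - \<epsilon>) * real (opt_makespan m ?N (set es))" .
    have "opt_makespan m ?N (set es) = 0 \<or> opt_makespan m ?N (set es) = 1" using opt by linarith
    then show False using ratio \<open>\<epsilon> > 0\<close> assms by auto
  qed
  then show ?thesis using instance_size_le_tower[OF assms] by blast
qed

end
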